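(* Let $Q$ be a quiver, let $\mathcal{P}$ be the set of all paths in $Q$ (including trivial paths), and let $\top_{\mathcal{P}}:=\{(p,q)\in\mathcal{P}\times\mathcal{P}\mid t(p)=s(q)\}$. Let $0\notin\mathcal{P}$ and let $\mathcal{P}^0:=\mathcal{P}\cup\{0\}$. Define a binary operation $\ast_{\mathcal{P}}:\mathcal{P}^0\times\mathcal{P}^0\to\mathcal{P}^0$ by $$p\ast_{\mathcal{P}}q:=\begin{cases}pq, & (p,q)\in\top_{\mathcal{P}},\\ 0, & (p,q)\notin\top_{\mathcal{P}},\end{cases}$$ where $pq$ is the composition of paths. Then $(\mathcal{P}^0,\ast_{\mathcal{P}})$ is a strong semigroup with zero.
   Context: A quiver $Q=(Q_0,Q_1,s,t)$ consists of a set $Q_0$ of vertices, a set $Q_1$ of arrows and maps $s,t:Q_1\to Q_0$. A path in $Q$ is either a trivial path $e_v$ for a vertex $v\in Q_0$, with $s(e_v)=t(e_v)=v$, or a sequence $p=\alpha_1\cdots\alpha_k$ ($k\ge1$) of arrows with $t(\alpha_i)=s(\alpha_{i+1})$ for $1\le i\le k-1$, with $s(p)=s(\alpha_1)$ and $t(p)=t(\alpha_k)$. If $t(p)=s(q)$, the composition $pq$ is the concatenation of $p$ and $q$, where trivial paths act as identities: $e_{s(p)}p=p=pe_{t(p)}$. A semigroup $T$ with zero $0$ is called strong if for all $a,b,c\in T$: $abc\neq0$ if and only if $ab\neq0$ and $bc\neq0$. *)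

theory Defs
  imports "Graph_Theory.Digraph"
begin

text \<open>
  A quiver is a \<^locale>\<open>wf_digraph\<close>: an arbitrary (possibly infinite, possibly empty) set of
  vertices and of arrows, loops and parallel arrows allowed, with source map \<^const>\<open>tail\<close>
  and target map \<^const>\<open>head\<close>.
\<close>

datatype ('v, 'a) quiver_path = Trivial 'v | Arrows "'a list"

definition quiver_paths :: "('v, 'a) pre_digraph \<Rightarrow> ('v, 'a) quiver_path set" where
  "quiver_paths Q =
     {Trivial v | v. v \<in> verts Q} \<union>
     {Arrows as | as. as \<noteq> [] \<and> set as \<subseteq> arcs Q \<and>
        successively (\<lambda>\<alpha> \<beta>. head Q \<alpha> = tail Q \<beta>) as}"

fun path_source :: "('v, 'a) pre_digraph \<Rightarrow> ('v, 'a) quiver_path \<Rightarrow> 'v" where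
  "path_source Q (Trivial v) = v"
| "path_source Q (Arrows as) = tail Q (hd as)"

fun path_target :: "('v, 'a) pre_digraph \<Rightarrow> ('v, 'a) quiver_path \<Rightarrow> 'v" where
  "path_target Q (Trivial v) = v"
| "path_target Q (Arrows as) = head Q (last as)"

text \<open>Meaningful only for composable pairs; the values on all other pairs are arbitrary.\<close>

fun path_comp ::
  "('v, 'a) quiver_path \<Rightarrow> ('v, 'a) quiver_path \<Rightarrow> ('v, 'a) quiver_path" where
  "path_comp (Trivial v) q = q"
| "path_comp (Arrows as) (Trivial v) = Arrows as"
| "path_comp (Arrows as) (Arrows bs) = Arrows (as @ bs)"

definition composable_paths ::
  "('v, 'a) pre_digraph \<Rightarrow> (('v, 'a) quiver_path \<times> ('v, 'a) quiver_path) set" where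
  "composable_paths Q =
     {(p, q) \<in> quiver_paths Q \<times> quiver_paths Q. path_target Q p = path_source Q q}"

text \<open>The adjoined zero is \<^const>\<open>None\<close>, which is distinct from every path \<open>Some p\<close>.\<close>

definition quiver_paths0 :: "('v, 'a) pre_digraph \<Rightarrow> ('v, 'a) quiver_path option set" where
  "quiver_paths0 Q = Some ` quiver_paths Q \<union> {None}"

fun path_mult0 :: "('v, 'a) pre_digraph \<Rightarrow> ('v, 'a) quiver_path option \<Rightarrow>
    ('v, 'a) quiver_path option \<Rightarrow> ('v, 'a) quiver_path option" where
  "path_mult0 Q (Some p) (Some q) =
     (if (p, q) \<in> composable_paths Q then Some (path_comp p q) else None)"
| "path_mult0 Q None y = None"
| "path_mult0 Q (Some p) None = None"

locale semigroup_with_zero =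
  fixes T :: "'t set" and mult :: "'t \<Rightarrow> 't \<Rightarrow> 't" (infixl \<open>\<cdot>\<close> 70) and zero :: 't
  assumes mult_closed: "\<lbrakk>a \<in> T; b \<in> T\<rbrakk> \<Longrightarrow> a \<cdot> b \<in> T"
    and mult_assoc: "\<lbrakk>a \<in> T; b \<in> T; c \<in> T\<rbrakk> \<Longrightarrow> (a \<cdot> b) \<cdot> c = a \<cdot> (b \<cdot> c)"
    and zero_closed: "zero \<in> T"
    and zero_left: "a \<in> T \<Longrightarrow> zero \<cdot> a = zero"
    and zero_right: "a \<in> T \<Longrightarrow> a \<cdot> zero = zero"

locale strong_semigroup_with_zero = semigroup_with_zero +
  assumes strong: "\<lbrakk>a \<in> T; b \<in> T; c \<in> T\<rbrakk> \<Longrightarrow>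
    a \<cdot> b \<cdot> c \<noteq> zero \<longleftrightarrow> a \<cdot> b \<noteq> zero \<and> b \<cdot> c \<noteq> zero"

end

theory Submission
  imports Defs
begin

text \<open>
  Composing two composable paths keeps the source of the first factor and the target of the
  second. Hence multiplying \<open>q\<close> by a path on one side does not affect which paths \<open>q\<close> can be
  composed with on the other side (\<open>composable_comp_left\<close>, \<open>composable_comp_right\<close>). So a triple
  product, with either bracketing, is nonzero exactly when both consecutive pairs are
  composable. This is strongness, and it also reduces associativity to the case where
  no zero occurs, in which it is associativity of concatenation.
\<close>

lemma path_comp_in_quiver_paths:
  assumes "(p, q) \<in> composable_paths Q"
  shows "path_comp p q \<in> quiver_paths Q"
  using assms
  by (cases p; cases q)
    (auto simp: composable_paths_def quiver_paths_def successively_append_iff)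

lemma path_source_comp:
  assumes "(p, q) \<in> composable_paths Q"
  shows "path_source Q (path_comp p q) = path_source Q p"
  using assms
  by (cases p; cases q) (auto simp: composable_paths_def quiver_paths_def)

lemma path_target_comp:
  assumes "(p, q) \<in> composable_paths Q"
  shows "path_target Q (path_comp p q) = path_target Q q"
  using assms
  by (cases p; cases q) (auto simp: composable_paths_def quiver_paths_def)

text \<open>
  A trivial left factor is discarded whatever its vertex, and so is a trivial right factor of a
  sequence of arrows; what remains is associativity of list concatenation.
\<close>

lemma path_comp_assoc: "path_comp (path_comp p q) r = path_comp p (path_comp q r)"
  by (cases p; cases q; cases r) auto

lemma composable_comp_left:
  assumes "(p, q) \<in> composable_paths Q"
  shows "(path_comp p q, r) \<in> composable_paths Q \<longleftrightarrow> (q, r) \<in> composable_paths Q"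
  using assms path_comp_in_quiver_paths[OF assms] path_target_comp[OF assms]
  by (auto simp: composable_paths_def)

lemma composable_comp_right:
  assumes "(q, r) \<in> composable_paths Q"
  shows "(p, path_comp q r) \<in> composable_paths Q \<longleftrightarrow> (p, q) \<in> composable_paths Q"
  using assms path_comp_in_quiver_paths[OF assms] path_source_comp[OF assms]
  by (auto simp: composable_paths_def)

theorem proposition4p6:
  fixes Q :: "('v, 'a) pre_digraph"
  assumes "wf_digraph Q"
  shows "strong_semigroup_with_zero (quiver_paths0 Q) (path_mult0 Q) None"
proof unfold_locales
  fix a b c :: "('v, 'a) quiver_path option"
  show "path_mult0 Q a b \<in> quiver_paths0 Q"
    by (cases a; cases b) (auto simp: quiver_paths0_def path_comp_in_quiver_paths)
  show "path_mult0 Q (path_mult0 Q a b) c = path_mult0 Q a (path_mult0 Q b c)"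
    by (cases a; cases b; cases c)
      (auto simp: composable_comp_left composable_comp_right path_comp_assoc)
  show "None \<in> quiver_paths0 Q"
    by (simp add: quiver_paths0_def)
  show "path_mult0 Q None a = None"
    by simp
  show "path_mult0 Q a None = None"
    by (cases a) auto
  show "path_mult0 Q (path_mult0 Q a b) c \<noteq> None \<longleftrightarrow>
      path_mult0 Q a b \<noteq> None \<and> path_mult0 Q b c \<noteq> None"
    by (cases a; cases b; cases c) (auto simp: composable_comp_left)
qed

end
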